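(* Let $K$ be a commutative ring, $\mathcal{R}$ a quasiassociative algebra over $K$, $\mathcal{M}$ a $K$-module, and $\chi:\mathcal{R}\to\mathrm{End}_K(\mathcal{M})$ a $K$-linear map with $\chi(a*b)=\chi(a)\chi(b)$ for all $a,b\in\mathcal{R}$; write $a.m=\chi(a)(m)$. Then the coboundary operator $\delta$ on cochains of $\mathcal{R}$ with values in $\mathcal{M}$ satisfies $\delta^2=0$; that is, $\delta(\delta\psi)=0$ for every $n\ge0$ and every $\psi\in C^n$, where for $n\ge3$ the cochain $\psi$ is assumed skewsymmetric in its first two arguments.
   Context: A quasiassociative algebra over $K$ is a $K$-module $\mathcal{R}$ with a $K$-bilinear multiplication $*$ satisfying $a*(b*c)-(a*b)*c=b*(a*c)-(b*a)*c$ for all $a,b,c\in\mathcal{R}$; put $[a,b]=a*b-b*a$. Let $C^0=\mathcal{M}$ and $C^n=\mathrm{Hom}_K(\mathcal{R}^{\otimes n},\mathcal{M})$ for $n\ge1$. The operator $\delta:C^n\to C^{n+1}$ is defined for $n\ge1$ by $$\delta\psi(a_1,\ldots,a_n,a)=\sum_{i=1}^n(-1)^{i+1}\left[\psi(a_1,\ldots,\widehat{a_i},\ldots,a_n,\,a_i*a)-a_i.\psi(a_1,\ldots,\widehat{a_i},\ldots,a_n,a)\right]+\sum_{1\le i<j\le n}(-1)^{i+j+1}\psi([a_i,a_j],a_1,\ldots,\widehat{a_i},\ldots,\widehat{a_j},\ldots,a_n,a),$$ where a hat means the argument is omitted and the last sum is absent for $n<2$; for $n=0$, $\delta\psi(a_1)=-a_1.\psi$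 for $\psi\in\mathcal{M}$. *)

theory Defs
  imports Complex_Main
begin

locale quasiassociative_algebra = module smult_R
  for smult_R :: "'k::comm_ring_1 \<Rightarrow> 'r::ab_group_add \<Rightarrow> 'r" +
  fixes mult :: "'r \<Rightarrow> 'r \<Rightarrow> 'r"
  assumes linear_left: "module_hom smult_R smult_R (\<lambda>a. mult a b)"
    and linear_right: "module_hom smult_R smult_R (\<lambda>b. mult a b)"
    and quasiassociative:
      "mult a (mult b c) - mult (mult a b) c = mult b (mult a c) - mult (mult b a) c"

text \<open>
  A \<open>K\<close>-linear map \<open>\<chi>\<close> from the algebra to \<open>End\<^sub>K(M)\<close>, with \<open>\<chi>(a * b) = \<chi>(a) \<chi>(b)\<close>.  As the
  module structure of \<open>End\<^sub>K(M)\<close> is pointwise, linearity of \<open>\<chi>\<close> is stated pointwise.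
\<close>

locale multiplicative_action =
  quasiassociative_algebra smult_R mult + M: module smult_M
  for smult_R :: "'k::comm_ring_1 \<Rightarrow> 'r::ab_group_add \<Rightarrow> 'r"
    and mult :: "'r \<Rightarrow> 'r \<Rightarrow> 'r"
    and smult_M :: "'k \<Rightarrow> 'm::ab_group_add \<Rightarrow> 'm" +
  fixes \<chi> :: "'r \<Rightarrow> 'm \<Rightarrow> 'm"
  assumes endomorphism: "module_hom smult_M smult_M (\<chi> a)"
    and linear: "module_hom smult_R smult_M (\<lambda>a. \<chi> a m)"
    and multiplicative: "\<chi> (mult a b) = \<chi> a \<circ> \<chi> b"

text \<open>
  An element of \<open>Hom\<^sub>K(R\<^sup>\<otimes>\<^sup>n, M)\<close> is given as the corresponding \<open>K\<close>-multilinear map of \<open>n\<close> arguments.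
  The arguments form a list of length \<open>n\<close>; on lists of any other length a cochain is \<open>0\<close>,
  so that equality of cochains is equality of functions.  For \<open>n = 0\<close> the element of \<open>M\<close> is
  the value at \<open>[]\<close>.
\<close>

definition cochains ::
  "('k::comm_ring_1 \<Rightarrow> 'r::ab_group_add \<Rightarrow> 'r) \<Rightarrow> ('k \<Rightarrow> 'm::ab_group_add \<Rightarrow> 'm) \<Rightarrow> nat
    \<Rightarrow> ('r list \<Rightarrow> 'm) set"
  where "cochains smult_R smult_M n =
    {\<psi>. (\<forall>xs i. length xs = n \<longrightarrow> i < n \<longrightarrow> module_hom smult_R smult_M (\<lambda>x. \<psi> (xs[i := x]))) \<and>
         (\<forall>xs. length xs \<noteq> n \<longrightarrow> \<psi> xs = 0)}"

definition skew_first_two :: "('r list \<Rightarrow> 'm::ab_group_add) \<Rightarrow> bool"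
  where "skew_first_two \<psi> \<longleftrightarrow> (\<forall>a b xs. \<psi> (a # b # xs) = - \<psi> (b # a # xs))"

text \<open>
  The argument list is \<open>[a\<^sub>1, \<dots>, a\<^sub>n, a] = as @ [a]\<close>.  List positions start at \<open>0\<close>, so the usual
  exponent \<open>i + 1\<close> becomes \<open>i + 2\<close>, written \<open>i\<close>, and \<open>i + j + 1\<close> keeps its parity.
\<close>

definition coboundary ::
  "('k::comm_ring_1 \<Rightarrow> 'm::ab_group_add \<Rightarrow> 'm) \<Rightarrow> ('r::ab_group_add \<Rightarrow> 'r \<Rightarrow> 'r)
    \<Rightarrow> ('r \<Rightarrow> 'm \<Rightarrow> 'm) \<Rightarrow> nat \<Rightarrow> ('r list \<Rightarrow> 'm) \<Rightarrow> ('r list \<Rightarrow> 'm)"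
  where "coboundary smult_M mult \<chi> n \<psi> xs =
    (if length xs \<noteq> Suc n then 0
     else if n = 0 then - \<chi> (hd xs) (\<psi> [])
     else let as = butlast xs; a = last xs in
       (\<Sum>i<n. smult_M ((-1) ^ i)
          (\<psi> (nths as (- {i}) @ [mult (as ! i) a]) - \<chi> (as ! i) (\<psi> (nths as (- {i}) @ [a])))) +
       (\<Sum>j<n. \<Sum>i<j. smult_M ((-1) ^ (i + j + 1))
          (\<psi> ((mult (as ! i) (as ! j) - mult (as ! j) (as ! i)) # nths as (- {i, j}) @ [a]))))"

end

theory Submission
  imports Defs
begin

text \<open>
  Write \<open>\<rho> y f a = f (y * a) - y.f(a)\<close>, which is minus the action of the commutator Lie algebra on
  \<open>Hom(R, M)\<close>; then \<open>\<delta>\<close> is, up to sign, the Chevalley--Eilenberg operator with coefficients in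
  \<open>Hom(R, M)\<close>.  In \<open>\<delta>(\<delta>\<psi>)\<close> the terms with two actions cancel the actions of brackets because
  \<open>-\<rho>\<close> is a Lie algebra action (quasiassociativity), the mixed terms cancel in pairs, the terms
  containing
  \<open>[[x,y],z]\<close> cancel by the Jacobi identity, and the terms containing two disjoint brackets cancel
  by skewsymmetry in the first two arguments.  The signs are handled by recursion on the argument
  list: each cancellation is an identity between iterated alternating sums over the ways to take
  out one or two list entries.
\<close>

section \<open>Alternating sums over entries taken out of a list\<close>

primrec alt_sum :: "'a list \<Rightarrow> ('a \<Rightarrow> 'a list \<Rightarrow> 'b::ab_group_add) \<Rightarrow> 'b" where
  "alt_sum [] h = 0"
| "alt_sum (x # xs) h = h x xs - alt_sum xs (\<lambda>y ys. h y (x # ys))"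

primrec alt_sum2 :: "'a list \<Rightarrow> ('a \<Rightarrow> 'a \<Rightarrow> 'a list \<Rightarrow> 'b::ab_group_add) \<Rightarrow> 'b" where
  "alt_sum2 [] h = 0"
| "alt_sum2 (x # xs) h = alt_sum2 xs (\<lambda>y z ys. h y z (x # ys)) - alt_sum xs (h x)"

lemma (in module) alt_sum_conv_sum:
  "alt_sum xs h = (\<Sum>i<length xs. scale ((-1) ^ i) (h (xs ! i) (nths xs (- {i}))))"
proof (induction xs arbitrary: h)
  case (Cons x xs)
  have "{j. Suc j \<noteq> 0} = (UNIV :: nat set)" "\<And>i. {j. Suc j \<noteq> Suc i} = - {i}"
    by auto
  then show ?case
    unfolding length_Cons sum.lessThan_Suc_shift alt_sum.simps Cons.IH
    by (simp add: nths_Cons nths_all sum_negf)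
qed simp

lemma (in module) alt_sum2_conv_sum:
  "alt_sum2 xs h =
    (\<Sum>j<length xs. \<Sum>i<j. scale ((-1) ^ (i + j)) (h (xs ! i) (xs ! j) (nths xs (- {i, j}))))"
proof (induction xs arbitrary: h)
  case (Cons x xs)
  have *: "{k. k \<noteq> i} = - {i}" "{k. k \<noteq> i \<and> k \<noteq> j} = - {i, j}" for i j :: nat
    by auto
  show ?case
    unfolding length_Cons sum.lessThan_Suc_shift alt_sum2.simps Cons.IH alt_sum_conv_sum
    by (simp add: nths_Cons * sum_subtractf sum_negf)
qed simp

lemma alt_sum_cong:
  assumes "\<And>y ys. Suc (length ys) = length xs \<Longrightarrow> h y ys = h' y ys"
  shows "alt_sum xs h = alt_sum xs h'"
  using assms
proof (induction xs arbitrary: h h')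
  case (Cons x xs)
  have "alt_sum xs (\<lambda>y ys. h y (x # ys)) = alt_sum xs (\<lambda>y ys. h' y (x # ys))"
    by (rule Cons.IH) (simp add: Cons.prems)
  then show ?case
    by (simp add: Cons.prems)
qed simp

lemma alt_sum2_cong:
  assumes "\<And>y z ys. Suc (Suc (length ys)) = length xs \<Longrightarrow> h y z ys = h' y z ys"
  shows "alt_sum2 xs h = alt_sum2 xs h'"
  using assms
proof (induction xs arbitrary: h h')
  case (Cons x xs)
  have "alt_sum2 xs (\<lambda>y z ys. h y z (x # ys)) = alt_sum2 xs (\<lambda>y z ys. h' y z (x # ys))"
    by (rule Cons.IH) (simp add: Cons.prems)
  moreover have "alt_sum xs (h x) = alt_sum xs (h' x)"
    by (rule alt_sum_cong) (simp add: Cons.prems)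
  ultimately show ?case
    by simp
qed simp

lemma alt_sum_diff: "alt_sum xs (\<lambda>y ys. g y ys - h y ys) = alt_sum xs g - alt_sum xs h"
  by (induction xs arbitrary: g h) simp_all

lemma alt_sum_add: "alt_sum xs (\<lambda>y ys. g y ys + h y ys) = alt_sum xs g + alt_sum xs h"
  by (induction xs arbitrary: g h) simp_all

lemma alt_sum2_diff: "alt_sum2 xs (\<lambda>y z ys. g y z ys - h y z ys) = alt_sum2 xs g - alt_sum2 xs h"
  by (induction xs arbitrary: g h) (simp_all add: alt_sum_diff)

lemma alt_sum2_add: "alt_sum2 xs (\<lambda>y z ys. g y z ys + h y z ys) = alt_sum2 xs g + alt_sum2 xs h"
  by (induction xs arbitrary: g h) (simp_all add: alt_sum_add)

lemma alt_sum_zero: "alt_sum xs (\<lambda>y ys. 0) = 0"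
  by (induction xs) simp_all

lemma alt_sum2_zero: "alt_sum2 xs (\<lambda>y z ys. 0) = 0"
  by (induction xs) (simp_all add: alt_sum_zero)

lemma additive_alt_sum:
  assumes "additive f"
  shows "f (alt_sum xs h) = alt_sum xs (\<lambda>y ys. f (h y ys))"
  by (induction xs arbitrary: h)
    (simp_all add: additive.zero[OF assms] additive.diff[OF assms])

lemma additive_alt_sum2:
  assumes "additive f"
  shows "f (alt_sum2 xs h) = alt_sum2 xs (\<lambda>y z ys. f (h y z ys))"
  by (induction xs arbitrary: h)
    (simp_all add: additive.zero[OF assms] additive.diff[OF assms] additive_alt_sum[OF assms])

text \<open>Of two entries, taking out the left one first moves the right one down by one position,
  which flips the sign; hence the difference.\<close>

lemma alt_sum_alt_sum:
  "alt_sum xs (\<lambda>y ys. alt_sum ys (h y)) = alt_sum2 xs (\<lambda>y z ys. h z y ys - h y z ys)"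
proof (induction xs arbitrary: h)
  case (Cons x xs)
  show ?case
    using Cons.IH[of "\<lambda>y z ys. h y z (x # ys)"] by (simp add: alt_sum_diff)
qed simp

lemma alt_sum_alt_sum_swap:
  "alt_sum xs (\<lambda>y ys. alt_sum ys (\<lambda>z. h z y)) = - alt_sum xs (\<lambda>y ys. alt_sum ys (h y))"
  by (simp add: alt_sum_alt_sum alt_sum2_diff)

text \<open>Moving the removal of one entry past that of a pair changes the sign twice. In the
  induction, pairs containing the head need \<open>alt_sum_alt_sum_swap\<close>.\<close>

lemma alt_sum_alt_sum2:
  "alt_sum xs (\<lambda>y ys. alt_sum2 ys (h y)) =
    alt_sum2 xs (\<lambda>z z' ys. alt_sum ys (\<lambda>y. h y z z'))"
proof (induction xs arbitrary: h)
  case (Cons x xs)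
  show ?case
    using Cons.IH[of "\<lambda>y z z' ys. h y z z' (x # ys)"] alt_sum_alt_sum_swap[of xs "\<lambda>y z. h y x z"]
    by (simp add: alt_sum_diff alt_sum2_diff)
qed simp

text \<open>A triple of entries splits into a pair and a single entry in three ways, with relative
  signs +, -, +: the pattern of the Jacobi identity.\<close>

lemma alt_sum2_alt_sum_cyclic:
  assumes "\<And>x y z ys. h x y z ys - h x z y ys + h y z x ys = 0"
  shows "alt_sum2 xs (\<lambda>x y ys. alt_sum ys (h x y)) = 0"
  using assms
proof (induction xs arbitrary: h)
  case (Cons x xs)
  have "h y z x ys - (h x z y ys - h x y z ys) = 0" for y z ys
    using Cons.prems[of x y z ys] by (simp add: algebra_simps)
  then have "alt_sum2 xs (\<lambda>y z ys. h y z x ys - (h x z y ys - h x y z ys)) = 0"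
    by (simp only: alt_sum2_zero)
  moreover have "alt_sum2 xs (\<lambda>y z ys. alt_sum ys (\<lambda>w ws. h y z w (x # ws))) = 0"
    by (rule Cons.IH) (rule Cons.prems)
  ultimately show ?case
    by (simp add: alt_sum_alt_sum alt_sum2_diff alt_sum2_zero)
qed simp

text \<open>
  That the iterated sum is invariant under swapping the two pairs would only give that twice the
  sum vanishes, which is not enough in characteristic 2.
\<close>

lemma alt_sum2_alt_sum2_skew:
  assumes "\<And>x x' y y' ys. h x x' y y' ys = - h y y' x x' ys"
  shows "alt_sum2 xs (\<lambda>x x' ys. alt_sum2 ys (h x x')) = 0"
  using assms
proof (induction xs arbitrary: h)
  case (Cons x xs)
  have cancel: "h x y z z' ws + h z z' x y ws = 0" for y z z' ws
    by (subst Cons.prems) simp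
  \<comment> \<open>A choice with the head in the first pair is matched with the one where the two
    pairs are swapped; each match is counted once, so no factor 2 arises.\<close>
  have "alt_sum xs (\<lambda>y ys. alt_sum2 ys (h x y)) + alt_sum xs (\<lambda>y ys. alt_sum2 ys (\<lambda>z z'. h z z' x y))
      = alt_sum xs (\<lambda>y ys. alt_sum2 ys (\<lambda>z z' ws. h x y z z' ws + h z z' x y ws))"
    by (simp add: alt_sum_add alt_sum2_add)
  also have "\<dots> = 0"
    by (simp add: cancel alt_sum2_zero alt_sum_zero)
  finally have "alt_sum xs (\<lambda>y ys. alt_sum2 ys (h x y))
      + alt_sum2 xs (\<lambda>z z' ys. alt_sum ys (h z z' x)) = 0"
    by (simp add: alt_sum_alt_sum2[of xs "\<lambda>y z z'. h z z' x y"])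
  moreover have "alt_sum2 xs (\<lambda>y z ys. alt_sum2 ys (\<lambda>w w' ws. h y z w w' (x # ws))) = 0"
    by (rule Cons.IH) (rule Cons.prems)
  ultimately show ?case
    by (simp add: alt_sum2_diff add_eq_0_iff)
qed simp

section \<open>The coboundary operator and its square\<close>

context multiplicative_action
begin

definition bracket :: "'r \<Rightarrow> 'r \<Rightarrow> 'r"
  where "bracket a b = mult a b - mult b a"

definition rho :: "'r \<Rightarrow> ('r \<Rightarrow> 'm) \<Rightarrow> 'r \<Rightarrow> 'm"
  where "rho y f a = f (mult y a) - \<chi> y (f a)"

text \<open>The last argument of a cochain is split off, so that \<open>c ys\<close> is an element of \<open>Hom(R, M)\<close>.\<close>

definition cob :: "('r list \<Rightarrow> 'r \<Rightarrow> 'm) \<Rightarrow> 'r list \<Rightarrow> 'r \<Rightarrow> 'm"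
  where "cob c xs a = alt_sum xs (\<lambda>y ys. rho y (c ys) a)
    - alt_sum2 xs (\<lambda>y z ys. c (bracket y z # ys) a)"

lemma mult_diff_left: "mult (a - b) c = mult a c - mult b c"
  using module_hom.diff[OF linear_left] .

lemma mult_diff_right: "mult a (b - c) = mult a b - mult a c"
  using module_hom.diff[OF linear_right] .

lemma chi_diff: "\<chi> a (m - m') = \<chi> a m - \<chi> a m'"
  using module_hom.diff[OF endomorphism] .

lemma chi_diff_left: "\<chi> (a - b) m = \<chi> a m - \<chi> b m"
  using module_hom.diff[OF linear] .

lemma additive_chi: "additive (\<chi> a)"
  by standard (rule module_hom.add[OF endomorphism])

text \<open>The associator is symmetric in its first two arguments, as in a left pre-Lie algebra, so
  the commutator is a Lie bracket.\<close>

lemma jacobi: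
  "bracket (bracket x y) z - bracket (bracket x z) y = - bracket (bracket y z) x"
proof -
  have "mult x (mult y z) = mult y (mult x z) + mult (mult x y) z - mult (mult y x) z" for x y z
    using quasiassociative[of x y z] by (simp add: algebra_simps)
  note this[of x y z] this[of x z y] this[of y z x]
  then show ?thesis
    by (simp add: bracket_def mult_diff_left mult_diff_right)
qed

text \<open>The mixed terms occur in both compositions and cancel; quasiassociativity collects the
  terms inside \<open>f\<close>, multiplicativity of \<chi> those outside.\<close>

lemma rho_commutator:
  assumes "\<And>a b. f (a - b) = f a - f b"
  shows "rho z (rho y f) a - rho y (rho z f) a = rho (bracket y z) f a"
proof -
  have "mult y (mult z a) - mult z (mult y a) = mult (bracket y z) a"
    using quasiassociative[of y z a] by (simp add: bracket_def mult_diff_left algebra_simps)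
  then have "f (mult y (mult z a)) - f (mult z (mult y a)) = f (mult (bracket y z) a)"
    by (metis assms)
  then show ?thesis
    by (simp add: rho_def bracket_def chi_diff chi_diff_left multiplicative algebra_simps)
qed

lemma rho_cob:
  "rho y (cob c xs) a = alt_sum xs (\<lambda>z ys. rho y (rho z (c ys)) a)
    - alt_sum2 xs (\<lambda>z z' ys. rho y (c (bracket z z' # ys)) a)"
  unfolding rho_def[of y] cob_def chi_diff alt_sum_diff alt_sum2_diff
  by (simp add: additive_alt_sum[OF additive_chi] additive_alt_sum2[OF additive_chi])

lemma cob_cob:
  assumes diff_last: "\<And>ys a b. c ys (a - b) = c ys a - c ys b"
    and diff_hd: "\<And>ys x y a. c ((x - y) # ys) a = c (x # ys) a - c (y # ys) a"
    and skew: "\<And>x y ys a. c (x # y # ys) a = - c (y # x # ys) a"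
  shows "cob (cob c) xs a = 0"
proof -
  have rho_rho: "alt_sum xs (\<lambda>y ys. alt_sum ys (\<lambda>z ws. rho y (rho z (c ws)) a))
      = alt_sum2 xs (\<lambda>y z ys. rho (bracket y z) (c ys) a)"
    by (simp add: alt_sum_alt_sum rho_commutator diff_last)
  have zero_hd: "c (0 # ys) b = 0" for ys b
    using diff_hd[of 0 0 ys b] by simp
  have "c (bracket (bracket x y) z # ys) a - c (bracket (bracket x z) y # ys) a
      + c (bracket (bracket y z) x # ys) a = 0" for x y z ys
  proof -
    \<comment> \<open>With \<open>0 -\<close> both sides are differences, as \<open>diff_hd\<close>
      requires.\<close>
    have "bracket (bracket x y) z - bracket (bracket x z) y = 0 - bracket (bracket y z) x"
      by (simp add: jacobi)
    then have "c (bracket (bracket x y) z # ys) a - c (bracket (bracket x z) y # ys) a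
      = c (0 # ys) a - c (bracket (bracket y z) x # ys) a"
      by (metis diff_hd)
    then show ?thesis
      by (simp add: zero_hd)
  qed
  then have nested: "alt_sum2 xs (\<lambda>x y ys. alt_sum ys
      (\<lambda>z ws. c (bracket (bracket x y) z # ws) a)) = 0"
    by (rule alt_sum2_alt_sum_cyclic)
  have disjoint: "alt_sum2 xs (\<lambda>x x' ys. alt_sum2 ys
      (\<lambda>y y' ws. c (bracket y y' # bracket x x' # ws) a)) = 0"
    by (rule alt_sum2_alt_sum2_skew) (rule skew)
  have "cob (cob c) xs a = alt_sum xs (\<lambda>y ys. rho y (cob c ys) a)
      - alt_sum2 xs (\<lambda>y z ys. cob c (bracket y z # ys) a)"
    by (rule cob_def)
  also have "\<dots> = 0"
    \<comment> \<open>Recursion at the head \<open>bracket y z\<close> separates bracket actions,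
      mixed terms, nested and disjoint brackets; \<open>alt_sum_alt_sum2\<close> cancels the mixed
      terms against those of \<open>rho_cob\<close>.\<close>
    unfolding rho_cob cob_def
    by (simp add: alt_sum_diff alt_sum2_diff rho_rho nested disjoint alt_sum_alt_sum2)
  finally show ?thesis .
qed

text \<open>The sign of \<open>alt_sum2\<close> is opposite to that in \<open>coboundary\<close>,
  hence the minus in \<open>cob\<close>. The case \<open>n = 0\<close> is separate because
  \<open>cob\<close> vanishes on the empty list.\<close>

lemma coboundary_snoc:
  assumes "0 < n" "length as = n"
  shows "coboundary smult_M mult \<chi> n \<psi> (as @ [a]) = cob (\<lambda>ys b. \<psi> (ys @ [b])) as a"
  using assms
  by (simp add: coboundary_def cob_def rho_def bracket_def Let_def M.alt_sum_conv_sum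
      M.alt_sum2_conv_sum sum_negf)

lemma coboundary_eq_0:
  "length xs \<noteq> Suc n \<Longrightarrow> coboundary smult_M mult \<chi> n \<psi> xs = 0"
  by (simp add: coboundary_def)

lemma coboundary_singleton: "coboundary smult_M mult \<chi> 0 \<psi> [a] = - \<chi> a (\<psi> [])"
  by (simp add: coboundary_def)

text \<open>A bracket replaces two entries by one, so both sums evaluate \<open>c\<close> at a
  single length. This allows rewriting with \<open>coboundary_snoc\<close> under
  \<open>cob\<close>.\<close>

lemma cob_cong:
  assumes "\<And>ys b. Suc (length ys) = length xs \<Longrightarrow> c ys b = c' ys b"
  shows "cob c xs a = cob c' xs a"
  unfolding cob_def rho_def
  by (intro arg_cong2[where f = minus] alt_sum_cong alt_sum2_cong) (simp_all add: assms)

end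

text \<open>At lengths other than \<open>n\<close> the default value 0 is linear too;
  \<open>cob_cob\<close> asks for additivity at all lengths.\<close>

lemma cochains_module_hom:
  assumes "\<psi> \<in> cochains smult_R smult_M n" "module smult_R" "module smult_M"
    and "i < length xs"
  shows "module_hom smult_R smult_M (\<lambda>x. \<psi> (xs[i := x]))"
proof (cases "length xs = n")
  case False
  then have "(\<lambda>x. \<psi> (xs[i := x])) = (\<lambda>x. 0)"
    using assms(1) by (auto simp: cochains_def)
  moreover have "module_hom smult_R smult_M (\<lambda>x. 0)"
    using assms(2,3) by (simp add: module_hom_iff module.scale_zero_right)
  ultimately show ?thesis
    by simp
qed (use assms in \<open>auto simp: cochains_def\<close>)

theorem proposition5p12:
  fixes smult_R :: "'k::comm_ring_1 \<Rightarrow> 'r::ab_group_add \<Rightarrow> 'r"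
    and smult_M :: "'k \<Rightarrow> 'm::ab_group_add \<Rightarrow> 'm"
    and mult :: "'r \<Rightarrow> 'r \<Rightarrow> 'r"
    and \<chi> :: "'r \<Rightarrow> 'm \<Rightarrow> 'm"
    and n :: nat
    and \<psi> :: "'r list \<Rightarrow> 'm"
  assumes "multiplicative_action smult_R mult smult_M \<chi>"
    and "\<psi> \<in> cochains smult_R smult_M n"
    and "3 \<le> n \<Longrightarrow> skew_first_two \<psi>"
  shows "coboundary smult_M mult \<chi> (n + 1) (coboundary smult_M mult \<chi> n \<psi>) = (\<lambda>_. 0)"
proof
  interpret multiplicative_action smult_R mult smult_M \<chi>
    by (rule assms(1))
  note hom = cochains_module_hom[OF assms(2) module_axioms M.module_axioms]
  let ?c = "\<lambda>ys b. \<psi> (ys @ [b])"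
  let ?d = "coboundary smult_M mult \<chi> n \<psi>"
  fix xs
  show "coboundary smult_M mult \<chi> (n + 1) ?d xs = 0"
  proof (cases "length xs = Suc (n + 1)")
    case True
    then obtain as a where xs: "xs = as @ [a]" and len: "length as = n + 1"
      by (cases xs rule: rev_cases) auto
    have "coboundary smult_M mult \<chi> (n + 1) ?d xs = cob (\<lambda>ys b. ?d (ys @ [b])) as a"
      unfolding xs by (rule coboundary_snoc) (use len in simp_all)
    also have "\<dots> = 0"
    proof (cases "n = 0")
      case True
      with len obtain y where "as = [y]"
        by (auto simp: length_Suc_conv)
      \<comment> \<open>On one entry \<open>cob\<close> is \<open>rho y\<close>, and the two terms
        (y * a).\<psi> and y.(a.\<psi>) cancel.\<close>
      with True show ?thesis
        by (simp add: cob_def rho_def coboundary_singleton multiplicative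
            additive.minus[OF additive_chi])
    next
      case False
      have "cob (\<lambda>ys b. ?d (ys @ [b])) as a = cob (cob ?c) as a"
        using False len by (intro cob_cong coboundary_snoc) auto
      also have "\<dots> = 0"
      proof (rule cob_cob)
        fix ys x y b
        show "\<psi> (ys @ [x - y]) = \<psi> (ys @ [x]) - \<psi> (ys @ [y])"
          using module_hom.diff[OF hom[of "length ys" "ys @ [0]"]] by simp
        show "\<psi> (((x - y) # ys) @ [b]) = \<psi> ((x # ys) @ [b]) - \<psi> ((y # ys) @ [b])"
          using module_hom.diff[OF hom[of 0 "0 # ys @ [b]"]] by simp
        show "\<psi> ((x # y # ys) @ [b]) = - \<psi> ((y # x # ys) @ [b])"
        \<comment> \<open>The list has at least three entries: either \<open>n\<close> is its
          length, so that 3 \<le> \<open>n\<close>, or both sides are the default 0.\<close>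
        proof (cases "length ys + 3 = n")
          case True
          then have "skew_first_two \<psi>"
            by (intro assms(3)) simp
          then show ?thesis
            unfolding skew_first_two_def append_Cons by blast
        next
          case False
          then show ?thesis
            using assms(2) by (simp add: cochains_def)
        qed
      qed
      finally show ?thesis .
    qed
    finally show ?thesis .
  qed (simp add: coboundary_eq_0)
qed

end
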